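(* Let $M$ be a separable Banach space structure and $\phi(x,y)=\|x+y\|$. If the type space $S_\phi(M)$ is strongly separable, then $\phi$ has NIP on $M$.
   Context: A Banach space is regarded as a structure of continuous logic by means of its unit ball: elements $a,b\in M$ below range over the unit ball, so $\phi(x,y)=\|x+y\|$ takes values in $[0,2]$. $S_\phi(M)$ is the space of complete $\phi$-types over $M$; it can be identified with the closure in $[0,2]^{M}$ (product topology) of the set of functions $f_b:M\to[0,2]$, $f_b(x)=\|x+b\|$, $b\in M$, and $\phi(p,a)$ denotes the value of the type $p$ at $a$. The $\rho$-metric on $S_\phi(M)$ is $\rho(p,q)=\sup_{a\in M,\ \|a\|\leqslant 1}|\phi(p,a)-\phi(q,a)|$. $S_\phi(M)$ is strongly separable if the metric space $(S_\phi(M),\rho)$ is separable. $\phi(x,y)$ has the independence property (IP) on $M$ if there are a sequence $(a_n)\subseteq M$ and reals $r>s$ such that for all finite disjoint $E,F\subseteq\mathbb N$ there is $b\in M$ with $\phi(a_n,b)\leqslant s$ for all $n\in E$ and $\phi(a_n,b)\geqslant r$ for all $n\in F$. Otherwise $\phi$ has NIP on $M$. *)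

theory Defs
  imports "HOL-Analysis.Analysis"
begin

text \<open>The continuous-logic structure of a Banach space \<^typ>\<open>'a::banach\<close> is its closed unit ball;
  this is the set \<open>M\<close> of parameters and of realisations below. No scalar multiplication occurs in
  the formula, so complex Banach spaces are covered through their underlying real spaces.\<close>

abbreviation unit_ball :: "'a::real_normed_vector set"
  where "unit_ball \<equiv> cball 0 1"

definition norm_formula :: "'a::real_normed_vector \<Rightarrow> 'a \<Rightarrow> real"
  where "norm_formula x y = norm (x + y)"

text \<open>The type space of a formula \<open>\<phi>\<close> with values in \<open>V\<close>: a type \<open>p\<close> over \<open>M\<close> is identified with the
  function \<open>a \<mapsto> \<phi>(p, a)\<close> on \<open>M\<close>. Functions on \<open>M\<close> are extensional (\<open>undefined\<close> outside \<open>M\<close>), so that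
  they are points of the library's product topology \<open>V\<^sup>M\<close>.\<close>

definition realized_type :: "('a \<Rightarrow> 'a \<Rightarrow> real) \<Rightarrow> 'a set \<Rightarrow> 'a \<Rightarrow> ('a \<Rightarrow> real)"
  where "realized_type \<phi> M b = (\<lambda>a\<in>M. \<phi> a b)"

definition type_space :: "('a \<Rightarrow> 'a \<Rightarrow> real) \<Rightarrow> real set \<Rightarrow> 'a set \<Rightarrow> ('a \<Rightarrow> real) set"
  where "type_space \<phi> V M =
    product_topology (\<lambda>_. top_of_set V) M closure_of (realized_type \<phi> M ` M)"

text \<open>The library's \<^locale>\<open>Metric_space\<close> requires symmetry and nonnegativity of the distance on the
  whole type, hence the value 0 off the type space.\<close>

definition type_rho :: "('a \<Rightarrow> 'a \<Rightarrow> real) \<Rightarrow> real set \<Rightarrow> 'a set \<Rightarrow> ('a \<Rightarrow> real) \<Rightarrow> ('a \<Rightarrow> real) \<Rightarrow> real"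
  where "type_rho \<phi> V M p q =
    (if p \<in> type_space \<phi> V M \<and> q \<in> type_space \<phi> V M then SUP a\<in>M. \<bar>p a - q a\<bar> else 0)"

definition strongly_separable :: "('a \<Rightarrow> 'a \<Rightarrow> real) \<Rightarrow> real set \<Rightarrow> 'a set \<Rightarrow> bool"
  where "strongly_separable \<phi> V M \<longleftrightarrow>
    separable_space (Metric_space.mtopology (type_space \<phi> V M) (type_rho \<phi> V M))"

definition IP_on :: "('a \<Rightarrow> 'a \<Rightarrow> real) \<Rightarrow> 'a set \<Rightarrow> bool"
  where "IP_on \<phi> M \<longleftrightarrow>
    (\<exists>(a :: nat \<Rightarrow> 'a) (r :: real) (s :: real). range a \<subseteq> M \<and> r > s \<and>
      (\<forall>E F. finite E \<and> finite F \<and> E \<inter> F = {} \<longrightarrow>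
        (\<exists>b\<in>M. (\<forall>n\<in>E. \<phi> (a n) b \<le> s) \<and> (\<forall>n\<in>F. \<phi> (a n) b \<ge> r))))"

definition NIP_on :: "('a \<Rightarrow> 'a \<Rightarrow> real) \<Rightarrow> 'a set \<Rightarrow> bool"
  where "NIP_on \<phi> M \<longleftrightarrow> \<not> IP_on \<phi> M"

lemma norm_formula_range:
  assumes "x \<in> unit_ball" "y \<in> unit_ball"
  shows "norm_formula x y \<in> {0..2}"
  using assms norm_triangle_ineq[of x y] by (auto simp: norm_formula_def)

lemma type_space_subset: "type_space \<phi> V M \<subseteq> M \<rightarrow>\<^sub>E V"
  using closure_of_subset_topspace[of "product_topology (\<lambda>_. top_of_set V) M" "realized_type \<phi> M ` M"]
  by (simp add: type_space_def)

lemma realized_type_in_type_space: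
  assumes "\<And>x y. x \<in> M \<Longrightarrow> y \<in> M \<Longrightarrow> \<phi> x y \<in> V" "b \<in> M"
  shows "realized_type \<phi> M b \<in> type_space \<phi> V M"
proof -
  have "realized_type \<phi> M ` M \<subseteq> topspace (product_topology (\<lambda>_. top_of_set V) M)"
    using assms(1) by (auto simp: realized_type_def)
  from closure_of_subset[OF this] show ?thesis
    using assms(2) by (auto simp: type_space_def)
qed

lemma Metric_space_type_rho:
  assumes V: "bounded V" and M: "M \<noteq> {}"
  shows "Metric_space (type_space \<phi> V M) (type_rho \<phi> V M)"
proof -
  let ?S = "type_space \<phi> V M"
  obtain B where B: "\<And>v. v \<in> V \<Longrightarrow> \<bar>v\<bar> \<le> B"
    using V by (auto simp: bounded_iff)
  have bdd: "bdd_above ((\<lambda>a. \<bar>p a - q a\<bar>) ` M)" if "p \<in> ?S" "q \<in> ?S" for p q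
  proof (rule bdd_aboveI2)
    fix a assume "a \<in> M"
    then have "p a \<in> V" "q a \<in> V"
      using that type_space_subset[of \<phi> V M] by auto
    then show "\<bar>p a - q a\<bar> \<le> 2 * B"
      using B[of "p a"] B[of "q a"] by linarith
  qed
  have upper: "\<bar>p a - q a\<bar> \<le> type_rho \<phi> V M p q" if "p \<in> ?S" "q \<in> ?S" "a \<in> M" for p q a
    using cSUP_upper[OF \<open>a \<in> M\<close> bdd[OF that(1,2)]] that by (simp add: type_rho_def)
  obtain a0 where a0: "a0 \<in> M" using M by blast
  show ?thesis
  proof
    fix p q
    show "0 \<le> type_rho \<phi> V M p q"
    proof (cases "p \<in> ?S \<and> q \<in> ?S")
      case True
      then show ?thesis using upper[of p q a0] a0 by (meson abs_ge_zero order_trans)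
    qed (auto simp: type_rho_def)
    show "type_rho \<phi> V M p q = type_rho \<phi> V M q p"
      by (auto simp: type_rho_def abs_minus_commute)
  next
    fix p q assume pq: "p \<in> ?S" "q \<in> ?S"
    show "type_rho \<phi> V M p q = 0 \<longleftrightarrow> p = q"
    proof
      assume eq: "type_rho \<phi> V M p q = 0"
      have "p a = q a" if "a \<in> M" for a
        using upper[OF pq that] eq by simp
      moreover have "p \<in> extensional M" "q \<in> extensional M"
        using pq type_space_subset[of \<phi> V M] by (auto simp: PiE_def)
      ultimately show "p = q" by (blast intro: extensionalityI)
    next
      assume "p = q"
      then show "type_rho \<phi> V M p q = 0" using M by (simp add: type_rho_def)
    qed
  next
    fix p q r assume S: "p \<in> ?S" "q \<in> ?S" "r \<in> ?S"
    have "(SUP a\<in>M. \<bar>p a - r a\<bar>) \<le> type_rho \<phi> V M p q + type_rho \<phi> V M q r"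
    proof (rule cSUP_least[OF M])
      fix a assume "a \<in> M"
      then show "\<bar>p a - r a\<bar> \<le> type_rho \<phi> V M p q + type_rho \<phi> V M q r"
        using upper[of p q a] upper[of q r a] S by linarith
    qed
    then show "type_rho \<phi> V M p r \<le> type_rho \<phi> V M p q + type_rho \<phi> V M q r"
      using S by (simp add: type_rho_def)
  qed
qed

end

theory Submission
  imports Defs
begin

text \<open>If \<open>(a\<^sub>n)\<close> and \<open>r > s\<close> witness the independence property, then compactness of the type space
  yields, for every \<open>A \<subseteq> \<nat>\<close>, a type \<open>p\<^sub>A\<close> with \<open>\<phi>(p\<^sub>A, a\<^sub>n) \<le> s\<close> for \<open>n \<in> A\<close> and \<open>\<phi>(p\<^sub>A, a\<^sub>n) \<ge> r\<close>
  for \<open>n \<notin> A\<close>. Distinct sets give types at \<open>\<rho>\<close>-distance at least \<open>r - s\<close>, so the type space has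
  an uncountable uniformly discrete subset and is not separable for \<open>\<rho>\<close>.\<close>

text \<open>Each \<open>p i\<close> has a point of a countable dense set within
  \<open>\<epsilon> / 2\<close>. By the triangle inequality two indices sharing such a point would
  violate the separation, so the choice injects \<open>I\<close> into the dense set.\<close>

lemma (in Metric_space) separable_imp_no_uncountable_separated_family:
  assumes sep: "separable_space mtopology" and \<epsilon>: "\<epsilon> > 0"
    and p: "\<And>i. i \<in> I \<Longrightarrow> p i \<in> M"
    and dist: "\<And>i j. i \<in> I \<Longrightarrow> j \<in> I \<Longrightarrow> i \<noteq> j \<Longrightarrow> d (p i) (p j) \<ge> \<epsilon>"
  shows "countable I"
proof -
  obtain D where D: "countable D" "D \<subseteq> M" "mtopology closure_of D = M"
    using sep by (auto simp: separable_space_def)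
  have "\<exists>x\<in>D. d (p i) x < \<epsilon> / 2" if "i \<in> I" for i
  proof -
    have "p i \<in> mtopology closure_of D" using D p[OF that] by simp
    then have "\<exists>y\<in>D. y \<in> mball (p i) (\<epsilon> / 2)" unfolding metric_closure_of
      using half_gt_zero[OF \<epsilon>] by blast
    then show ?thesis by auto
  qed
  then obtain f where f: "\<And>i. i \<in> I \<Longrightarrow> f i \<in> D" "\<And>i. i \<in> I \<Longrightarrow> d (p i) (f i) < \<epsilon> / 2"
    by metis
  have "inj_on f I"
  proof (rule inj_onI, rule ccontr)
    fix i j assume ij: "i \<in> I" "j \<in> I" "f i = f j" "i \<noteq> j"
    have "d (p i) (p j) \<le> d (p i) (f i) + d (f i) (p j)"
      using triangle p ij(1,2) f(1) D(2) by blast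
    also have "d (f i) (p j) = d (p j) (f j)" using ij commute by metis
    finally show False using f(2)[OF ij(1)] f(2)[OF ij(2)] dist[OF ij(1,2,4)] by linarith
  qed
  moreover have "f ` I \<subseteq> D" using f by blast
  ultimately show ?thesis
    using D(1) countable_image_inj_on countable_subset by blast
qed

text \<open>By Tychonoff the product is compact, and closedness of the \<open>C n\<close> lets all
  constraints pass to the limit: the types meeting the first constraints form a decreasing sequence
  of nonempty closed sets.\<close>

lemma ex_type_of_finite_approximations:
  assumes V: "compact V" and rng: "\<And>x y. x \<in> M \<Longrightarrow> y \<in> M \<Longrightarrow> \<phi> x y \<in> V"
    and a: "range a \<subseteq> M" and C: "\<And>n :: nat. closed (C n)"
    and fin: "\<And>n. \<exists>b\<in>M. \<forall>k\<le>n. \<phi> (a k) b \<in> C k"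
  shows "\<exists>p\<in>type_space \<phi> V M. \<forall>n. p (a n) \<in> C n"
proof -
  let ?X = "product_topology (\<lambda>_. top_of_set V) M"
  \<comment> \<open>Writing \<open>V \<inter> C k\<close> makes each constraint the preimage of a
    closed subset of the factor \<open>top_of_set V\<close>.\<close>
  define K where "K n = type_space \<phi> V M \<inter> (\<Inter>k\<le>n. {p \<in> topspace ?X. p (a k) \<in> V \<inter> C k})" for n
  have comp: "compact_space ?X"
    using V by (simp add: compact_space_product_topology compact_space_subtopology)
  have "closedin ?X {p \<in> topspace ?X. p (a k) \<in> V \<inter> C k}" for k
  proof (rule closedin_continuous_map_preimage)
    show "continuous_map ?X (top_of_set V) (\<lambda>p. p (a k))"
      using a by (intro continuous_map_product_projection) auto
    show "closedin (top_of_set V) (V \<inter> C k)"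
      using C by (auto simp: closedin_closed)
  qed
  then have "closedin ?X (K n)" for n
    unfolding K_def type_space_def by (intro closedin_Int closedin_INT closedin_closure_of) auto
  moreover have "K n \<noteq> {}" for n
  proof -
    obtain b where b: "b \<in> M" "\<forall>k\<le>n. \<phi> (a k) b \<in> C k" using fin by blast
    have "realized_type \<phi> M b \<in> K n"
      using b a rng realized_type_in_type_space[of M \<phi> V b]
      by (auto simp: K_def realized_type_def)
    then show ?thesis by blast
  qed
  moreover have "decseq K" by (rule decseq_SucI) (auto simp: K_def)
  ultimately have "(\<Inter>n. K n) \<noteq> {}"
    using compact_space_imp_nest[OF comp] by blast
  then obtain p where p: "\<And>n. p \<in> K n" by blast
  have "p \<in> type_space \<phi> V M" "p (a n) \<in> C n" for n
    using p[of n] by (auto simp: K_def)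
  then show ?thesis by blast
qed

lemma type_rho_upper:
  assumes V: "bounded V" and p: "p \<in> type_space \<phi> V M" and q: "q \<in> type_space \<phi> V M"
    and a: "a \<in> M"
  shows "\<bar>p a - q a\<bar> \<le> type_rho \<phi> V M p q"
proof -
  obtain B where B: "\<And>v. v \<in> V \<Longrightarrow> \<bar>v\<bar> \<le> B"
    using V by (auto simp: bounded_iff)
  have "bdd_above ((\<lambda>a. \<bar>p a - q a\<bar>) ` M)"
  proof (rule bdd_aboveI2)
    fix x assume "x \<in> M"
    then have "p x \<in> V" "q x \<in> V"
      using p q type_space_subset[of \<phi> V M] by auto
    then show "\<bar>p x - q x\<bar> \<le> 2 * B"
      using B[of "p x"] B[of "q x"] by linarith
  qed
  from cSUP_upper[OF a this] show ?thesis using p q by (simp add: type_rho_def)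
qed

theorem strongly_separable_imp_NIP_on:
  assumes V: "compact V" and rng: "\<And>x y. x \<in> M \<Longrightarrow> y \<in> M \<Longrightarrow> \<phi> x y \<in> V"
    and sep: "strongly_separable \<phi> V M"
  shows "NIP_on \<phi> M"
  unfolding NIP_on_def
proof
  assume "IP_on \<phi> M"
  then obtain a :: "nat \<Rightarrow> 'a" and r s :: real where a: "range a \<subseteq> M" and rs: "r > s"
    and ip: "\<forall>E F. finite E \<and> finite F \<and> E \<inter> F = {} \<longrightarrow>
      (\<exists>b\<in>M. (\<forall>n\<in>E. \<phi> (a n) b \<le> s) \<and> (\<forall>n\<in>F. \<phi> (a n) b \<ge> r))"
    unfolding IP_on_def by (elim exE conjE) (rule that)
  have "\<exists>p\<in>type_space \<phi> V M. \<forall>n. p (a n) \<in> (if n \<in> A then {..s} else {r..})" for A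
  proof (rule ex_type_of_finite_approximations[OF V rng a])
    fix n
    \<comment> \<open>For arbitrary \<open>A\<close>, the independence property is applied only to
      the finite traces of \<open>A\<close> and of its complement on \<open>{..n}\<close>.\<close>
    obtain b where "b \<in> M" "\<forall>k\<in>{..n} \<inter> A. \<phi> (a k) b \<le> s" "\<forall>k\<in>{..n} - A. \<phi> (a k) b \<ge> r"
      using ip[rule_format, of "{..n} \<inter> A" "{..n} - A"] by auto
    then show "\<exists>b\<in>M. \<forall>k\<le>n. \<phi> (a k) b \<in> (if k \<in> A then {..s} else {r..})"
      by (intro bexI[of _ b]) auto
  qed auto
  then obtain p where p: "\<And>A. p A \<in> type_space \<phi> V M"
    and pa: "\<And>A n. p A (a n) \<in> (if n \<in> A then {..s} else {r..})"
    by metis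
  have far: "type_rho \<phi> V M (p A) (p B) \<ge> r - s" if AB: "A \<noteq> B" for A B
  proof -
    \<comment> \<open>At an index in exactly one of the two sets, one type has value at most
      \<open>s\<close> and the other at least \<open>r\<close>.\<close>
    obtain n where "n \<in> A \<longleftrightarrow> n \<notin> B" using AB by blast
    then have "r - s \<le> \<bar>p A (a n) - p B (a n)\<bar>"
      using pa[of A n] pa[of B n] by (auto split: if_splits)
    also have "\<dots> \<le> type_rho \<phi> V M (p A) (p B)"
      using a by (intro type_rho_upper compact_imp_bounded V p) auto
    finally show ?thesis .
  qed
  \<comment> \<open>The set \<open>M\<close> is nonempty because it contains the range of
    \<open>a\<close>.\<close>
  interpret Metric_space "type_space \<phi> V M" "type_rho \<phi> V M"
    using V a by (intro Metric_space_type_rho compact_imp_bounded) auto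
  \<comment> \<open>All subsets of the naturals index the separated family, so separability would
    contradict Cantor's theorem.\<close>
  have "countable (UNIV :: nat set set)"
    using separable_imp_no_uncountable_separated_family[of "r - s" UNIV p] sep p far rs
    by (simp add: strongly_separable_def)
  then obtain f :: "nat set \<Rightarrow> nat" where "inj f"
    by (auto simp: countable_def)
  then have "surj (inv f)" by (rule inj_imp_surj_inv)
  then show False using Cantors_theorem[of UNIV] by auto
qed

theorem mainTheorem4:
  assumes "separable_space (euclidean :: 'a::banach topology)"
    and "strongly_separable norm_formula {0..2} (unit_ball :: 'a set)"
  shows "NIP_on norm_formula (unit_ball :: 'a set)"
  \<comment> \<open>The triangle inequality puts the values on the unit ball into the compact
    interval \<open>{0..2}\<close>.\<close>
  using norm_formula_range assms(2) by (intro strongly_separable_imp_NIP_on[of "{0..2}"]) auto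

end
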